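(* Let $\lambda=\lambda_1\otimes\lambda_2$ be a product of finite, positive, nonzero measures on $\Omega=\Omega_1\times\Omega_2$, and let $f_\mu$ be an arbitrary element of $\mathcal{B}^2(\lambda)$. Then the independence part $f_{\mu,\mathrm{ind}}=f_{\mu,1}\oplus f_{\mu,2}$ is the unique orthogonal projection of $f_\mu$ on $\mathcal{B}^2_{\mathrm{ind}}(\lambda)$.
   Context: Bayes space. For a finite, positive, nonzero measure $\lambda$ on a measurable space $(\Omega,\mathcal{A})$, $\mathcal{M}(\lambda)$ is the set of $\sigma$-finite positive measures $\mu$ on $(\Omega,\mathcal A)$ with the same null sets as $\lambda$; $\mu$ is identified with its $\lambda$-density $f_\mu=d\mu/d\lambda$. Write $f_\mu\propto f_\nu$ if $f_\mu=c f_\nu$ ($\lambda$-a.e.) for some $c\in(0,\infty)$. The Bayes space is $\mathcal{B}(\lambda)=\mathcal{M}(\lambda)/\!\propto$; equality of elements means $\propto$. Vector space operations: $f\oplus g\propto fg$, $\alpha\odot f\propto f^{\alpha}$, $f\ominus g=f\oplus((-1)\odot g)$; the neutral element is the constant density $1$. $\mathcal{B}^2(\lambda)=\{f\in\mathcal{B}(\lambda):\int_\Omega|\ln f|^2d\lambda<\infty\}$ is a Hilbert space with inner product $\langle f,g\rangle_{\mathcal{B}^2(\lambda)}=\frac{1}{2\lambda(\Omega)}\int_\Omega\int_\Omega \ln\{f(\omega)/f(\omega')\}\ln\{g(\omega)/g(\omega')\}\,d\lambda(\omega)\,d\lambda(\omega')$. Bivariate setting. $(\Omega_i,\mathcal{A}_i,\lambda_i)$,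 $i\in\{1,2\}$, are measurable spaces with finite, positive, nonzero measures; $\Omega=\Omega_1\times\Omega_2$, $\mathcal A=\mathcal A_1\otimes\mathcal A_2$, $\lambda=\lambda_1\otimes\lambda_2$. The independence space is $\mathcal{B}^2_{\mathrm{ind}}(\lambda)=\{\mu\in\mathcal{B}^2(\lambda):\mu=\mu_1\otimes\mu_2\text{ for some }\mu_1\in\mathcal{B}^2(\lambda_1),\mu_2\in\mathcal{B}^2(\lambda_2)\}$. Geometric margins of $f_\mu\in\mathcal{B}^2(\lambda)$: $f_{\mu,1}(\omega_1,\omega_2)\equiv f_{\mu,1}(\omega_1)\propto\exp[\frac1{\lambda_2(\Omega_2)}\int_{\Omega_2}\ln\{f_\mu(\omega_1,\omega^* )\}d\lambda_2(\omega^* )]$ and $f_{\mu,2}(\omega_1,\omega_2)\equiv f_{\mu,2}(\omega_2)\propto\exp[\frac1{\lambda_1(\Omega_1)}\int_{\Omega_1}\ln\{f_\mu(\omega^*,\omega_2)\}d\lambda_1(\omega^* )]$. *)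

theory Defs
  imports "HOL-Analysis.Analysis"
begin

section \<open>Bayes spaces\<close>

definition bayes_measures :: "'a measure \<Rightarrow> 'a measure set" where
  "bayes_measures L =
     {\<mu>. sets \<mu> = sets L \<and> sigma_finite_measure \<mu> \<and> null_sets \<mu> = null_sets L}"

text \<open>For \<open>\<mu>\<close> in \<open>bayes_measures L\<close> the extended nonnegative derivative \<^term>\<open>RN_deriv L \<mu>\<close> lies strictly
  between \<open>0\<close> and \<open>\<infinity>\<close> almost everywhere, so nothing is lost by passing to the reals.\<close>

definition real_density :: "'a measure \<Rightarrow> 'a measure \<Rightarrow> 'a \<Rightarrow> real" where
  "real_density L \<mu> x = enn2real (RN_deriv L \<mu> x)"

definition prop_rel :: "'a measure \<Rightarrow> ('a measure \<times> 'a measure) set" where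
  "prop_rel L = {(\<mu>, \<nu>). \<mu> \<in> bayes_measures L \<and> \<nu> \<in> bayes_measures L \<and>
     (\<exists>c::real. 0 < c \<and> (AE x in L. real_density L \<mu> x = c * real_density L \<nu> x))}"

lemma equiv_prop_rel: "equiv (bayes_measures L) (prop_rel L)"
proof (rule equivI)
  show "prop_rel L \<subseteq> bayes_measures L \<times> bayes_measures L"
    by (auto simp: prop_rel_def)
  show "refl_on (bayes_measures L) (prop_rel L)"
    by (auto simp: refl_on_def prop_rel_def intro!: exI[of _ "1::real"])
  show "sym (prop_rel L)"
  proof (rule symI)
    fix \<mu> \<nu> assume "(\<mu>, \<nu>) \<in> prop_rel L"
    then obtain c :: real where c: "\<mu> \<in> bayes_measures L" "\<nu> \<in> bayes_measures L" "0 < c"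
      "AE x in L. real_density L \<mu> x = c * real_density L \<nu> x"
      by (auto simp: prop_rel_def)
    have "AE x in L. real_density L \<nu> x = (1 / c) * real_density L \<mu> x"
      using c(4) by eventually_elim (use c(3) in simp)
    moreover have "0 < 1 / c"
      using c(3) by simp
    ultimately show "(\<nu>, \<mu>) \<in> prop_rel L"
      using c(1,2) unfolding prop_rel_def by blast
  qed
  show "trans (prop_rel L)"
  proof (rule transI)
    fix \<mu> \<nu> \<rho> assume "(\<mu>, \<nu>) \<in> prop_rel L" "(\<nu>, \<rho>) \<in> prop_rel L"
    then obtain c d :: real where c: "\<mu> \<in> bayes_measures L" "\<rho> \<in> bayes_measures L" "0 < c" "0 < d"
      "AE x in L. real_density L \<mu> x = c * real_density L \<nu> x"
      "AE x in L. real_density L \<nu> x = d * real_density L \<rho> x"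
      by (auto simp: prop_rel_def)
    have "AE x in L. real_density L \<mu> x = (c * d) * real_density L \<rho> x"
      using c(5,6) by eventually_elim simp
    moreover have "0 < c * d"
      using c(3,4) by simp
    ultimately show "(\<mu>, \<rho>) \<in> prop_rel L"
      using c(1,2) unfolding prop_rel_def by blast
  qed
qed

definition bayes_space :: "'a measure \<Rightarrow> 'a measure set set" where
  "bayes_space L = bayes_measures L // prop_rel L"

definition bayes_class :: "'a measure \<Rightarrow> 'a measure \<Rightarrow> 'a measure set" where
  "bayes_class L \<mu> = prop_rel L `` {\<mu>}"

definition class_of_density :: "'a measure \<Rightarrow> ('a \<Rightarrow> real) \<Rightarrow> 'a measure set" where
  "class_of_density L f = bayes_class L (density L (\<lambda>x. ennreal (f x)))"

text \<open>The density of a chosen representative.  It is determined by the class only up to a positive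
  factor and a null set; all constructions below are insensitive to both.\<close>

definition bayes_density :: "'a measure \<Rightarrow> 'a measure set \<Rightarrow> 'a \<Rightarrow> real" where
  "bayes_density L F = real_density L (SOME \<mu>. \<mu> \<in> F)"

definition bayes_add :: "'a measure \<Rightarrow> 'a measure set \<Rightarrow> 'a measure set \<Rightarrow> 'a measure set" where
  "bayes_add L F G = class_of_density L (\<lambda>x. bayes_density L F x * bayes_density L G x)"

definition bayes_scale :: "'a measure \<Rightarrow> real \<Rightarrow> 'a measure set \<Rightarrow> 'a measure set" where
  "bayes_scale L \<alpha> F = class_of_density L (\<lambda>x. bayes_density L F x powr \<alpha>)"

definition bayes_diff :: "'a measure \<Rightarrow> 'a measure set \<Rightarrow> 'a measure set \<Rightarrow> 'a measure set" where
  "bayes_diff L F G = bayes_add L F (bayes_scale L (-1) G)"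

definition bayes_L2 :: "'a measure \<Rightarrow> 'a measure set set" where
  "bayes_L2 L = {F \<in> bayes_space L. integrable L (\<lambda>x. \<bar>ln (bayes_density L F x)\<bar>\<^sup>2)}"

definition bayes_inner :: "'a measure \<Rightarrow> 'a measure set \<Rightarrow> 'a measure set \<Rightarrow> real" where
  "bayes_inner L F G = 1 / (2 * measure L (space L)) *
     (LINT y|L. LINT x|L.
        ln (bayes_density L F x / bayes_density L F y) *
        ln (bayes_density L G x / bayes_density L G y))"

definition bayes_orthogonal_projection ::
  "'a measure \<Rightarrow> 'a measure set set \<Rightarrow> 'a measure set \<Rightarrow> 'a measure set \<Rightarrow> bool" where
  "bayes_orthogonal_projection L S F P \<longleftrightarrow>
     P \<in> S \<and> (\<forall>G\<in>S. bayes_inner L (bayes_diff L F P) G = 0)"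

section \<open>The bivariate setting\<close>

definition bayes_ind :: "'a measure \<Rightarrow> 'b measure \<Rightarrow> ('a \<times> 'b) measure set set" where
  "bayes_ind L1 L2 = {F \<in> bayes_L2 (L1 \<Otimes>\<^sub>M L2).
     \<exists>\<mu>1 \<in> bayes_measures L1. \<exists>\<mu>2 \<in> bayes_measures L2.
       bayes_class L1 \<mu>1 \<in> bayes_L2 L1 \<and> bayes_class L2 \<mu>2 \<in> bayes_L2 L2 \<and>
       F = bayes_class (L1 \<Otimes>\<^sub>M L2) (\<mu>1 \<Otimes>\<^sub>M \<mu>2)}"

text \<open>Both geometric margins are regarded as elements of the Bayes space over the product, by means
  of densities that depend on one coordinate only.\<close>

definition geometric_margin1 ::
  "'a measure \<Rightarrow> 'b measure \<Rightarrow> ('a \<times> 'b) measure set \<Rightarrow> ('a \<times> 'b) measure set" where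
  "geometric_margin1 L1 L2 F = class_of_density (L1 \<Otimes>\<^sub>M L2)
     (\<lambda>(x, y). exp (1 / measure L2 (space L2) *
        (LINT z|L2. ln (bayes_density (L1 \<Otimes>\<^sub>M L2) F (x, z)))))"

definition geometric_margin2 ::
  "'a measure \<Rightarrow> 'b measure \<Rightarrow> ('a \<times> 'b) measure set \<Rightarrow> ('a \<times> 'b) measure set" where
  "geometric_margin2 L1 L2 F = class_of_density (L1 \<Otimes>\<^sub>M L2)
     (\<lambda>(x, y). exp (1 / measure L1 (space L1) *
        (LINT z|L1. ln (bayes_density (L1 \<Otimes>\<^sub>M L2) F (z, y)))))"

definition independence_part ::
  "'a measure \<Rightarrow> 'b measure \<Rightarrow> ('a \<times> 'b) measure set \<Rightarrow> ('a \<times> 'b) measure set" where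
  "independence_part L1 L2 F =
     bayes_add (L1 \<Otimes>\<^sub>M L2) (geometric_margin1 L1 L2 F) (geometric_margin2 L1 L2 F)"

end

theory Submission
  imports Defs
begin

text \<open>Taking logarithms of densities turns \<^term>\<open>bayes_L2 M\<close> into the square integrable functions modulo
  constants: \<open>\<oplus>\<close> becomes addition, and the inner product becomes the unnormalised covariance
  \<open>centred_product M u v = \<integral>uv - (\<integral>u)(\<integral>v) / M(\<Omega>)\<close>, which does not see additive constants. All freedom
  in choosing a representative of a class, or a density of it, is an additive constant almost
  everywhere, so every class is handled through one function \<open>log_density M F\<close> known up to such a
  constant.

  In this picture the elements of \<open>bayes_ind M1 M2\<close> are exactly the sums \<open>f(x) + g(y)\<close> with \<open>f\<close> and \<open>g\<close>
  square integrable (\<open>bayes_ind_iff\<close>), and the independence part of \<open>F\<close>, with \<open>u = log_density F\<close>, has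
  the logarithm \<open>a(x) + b(y)\<close>, where \<open>a\<close> and \<open>b\<close> are the averages of \<open>u\<close> over the other coordinate
  (\<open>independence_part_log\<close>). The averages are square integrable by the Cauchy-Schwarz inequality.
  Integrating the residual \<open>u - a - b\<close> over \<open>y\<close> for almost every \<open>x\<close> cancels \<open>u\<close> against \<open>a\<close> and leaves
  the constant \<open>-\<integral>b\<close>. A function whose \<open>x\<close>-sections almost all have the same integral has
  covariance zero with every \<open>f(x)\<close>, by Fubini; by symmetry the residual is also orthogonal to every
  \<open>g(y)\<close> (\<open>residual_orthogonal\<close>).

  Uniqueness holds for orthogonal projections on any set of square integrable classes
  (\<open>bayes_orthogonal_projection_unique\<close>): the difference of the logarithms of two projections is
  orthogonal to both of them, hence to itself, and zero variance makes it constant.\<close>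

section \<open>Square integrable functions and their centred product\<close>

definition square_integrable :: "'a measure \<Rightarrow> ('a \<Rightarrow> real) \<Rightarrow> bool" where
  "square_integrable M u \<longleftrightarrow> u \<in> borel_measurable M \<and> integrable M (\<lambda>x. (u x)\<^sup>2)"

text \<open>The covariance of \<open>u\<close> and \<open>v\<close> under \<open>M\<close> normalised to a probability measure, times the total mass of
  \<open>M\<close>.\<close>

definition centred_product :: "'a measure \<Rightarrow> ('a \<Rightarrow> real) \<Rightarrow> ('a \<Rightarrow> real) \<Rightarrow> real" where
  "centred_product M u v = (\<integral>x. u x * v x \<partial>M) - (\<integral>x. u x \<partial>M) * (\<integral>x. v x \<partial>M) / measure M (space M)"

lemma square_integrable_mult_integrable:
  assumes "square_integrable M u" "square_integrable M v"
  shows "integrable M (\<lambda>x. u x * v x)"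
proof (rule Bochner_Integration.integrable_bound)
  show "integrable M (\<lambda>x. (u x)\<^sup>2 + (v x)\<^sup>2)"
    using assms by (simp add: square_integrable_def)
  show "(\<lambda>x. u x * v x) \<in> borel_measurable M"
    using assms by (auto simp: square_integrable_def)
  have "\<bar>a * b\<bar> \<le> a\<^sup>2 + b\<^sup>2" for a b :: real
    using sum_squares_bound[of "\<bar>a\<bar>" "\<bar>b\<bar>"]
      mult_nonneg_nonneg[OF abs_ge_zero[of a] abs_ge_zero[of b]]
    unfolding abs_mult power2_abs by linarith
  then show "AE x in M. norm (u x * v x) \<le> norm ((u x)\<^sup>2 + (v x)\<^sup>2)"
    by simp
qed

lemma square_integrable_add:
  assumes "square_integrable M u" "square_integrable M v"
  shows "square_integrable M (\<lambda>x. u x + v x)"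
  using assms square_integrable_mult_integrable[OF assms]
  by (auto simp: square_integrable_def power2_sum mult.assoc)

lemma square_integrable_scale:
  "square_integrable M u \<Longrightarrow> square_integrable M (\<lambda>x. c * u x)"
  by (auto simp: square_integrable_def power_mult_distrib)

lemma square_integrable_diff:
  assumes "square_integrable M u" "square_integrable M v"
  shows "square_integrable M (\<lambda>x. u x - v x)"
  using square_integrable_add[OF assms(1) square_integrable_scale[OF assms(2), of "-1"]] by simp

lemma square_integrable_cong_AE:
  assumes "u \<in> borel_measurable M" "square_integrable M v" "AE x in M. u x = v x"
  shows "square_integrable M u"
proof -
  have "AE x in M. (v x)\<^sup>2 = (u x)\<^sup>2"
    using assms(3) by eventually_elim simp
  then have "integrable M (\<lambda>x. (u x)\<^sup>2)"
    using assms integrable_cong_AE[of "\<lambda>x. (v x)\<^sup>2" M "\<lambda>x. (u x)\<^sup>2"]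
    by (auto simp: square_integrable_def)
  then show ?thesis
    using assms by (simp add: square_integrable_def)
qed

context finite_measure
begin

lemma square_integrable_const: "square_integrable M (\<lambda>x. c)"
  by (simp add: square_integrable_def)

lemma square_integrable_integrable: "square_integrable M u \<Longrightarrow> integrable M u"
  unfolding square_integrable_def by (blast intro: square_integrable_imp_integrable)

lemma square_integrable_up_to_const:
  assumes "u \<in> borel_measurable M" "square_integrable M v" "AE x in M. u x = v x + c"
  shows "square_integrable M u"
proof (rule square_integrable_cong_AE[OF assms(1)])
  show "square_integrable M (\<lambda>x. v x + c)"
    by (rule square_integrable_add[OF assms(2) square_integrable_const])
qed (rule assms(3))

lemma centred_product_diff_left:
  assumes "square_integrable M u" "square_integrable M v" "square_integrable M w"
  shows "centred_product M (\<lambda>x. u x - v x) w = centred_product M u w - centred_product M v w"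
proof -
  note square_integrable_mult_integrable[OF assms(1,3)] square_integrable_mult_integrable[OF assms(2,3)]
    assms[THEN square_integrable_integrable]
  then show ?thesis
    by (simp add: centred_product_def left_diff_distrib diff_divide_distrib)
qed

lemma centred_product_add_right:
  assumes "square_integrable M u" "square_integrable M v" "square_integrable M w"
  shows "centred_product M u (\<lambda>x. v x + w x) = centred_product M u v + centred_product M u w"
proof -
  note square_integrable_mult_integrable[OF assms(1,2)] square_integrable_mult_integrable[OF assms(1,3)]
    assms[THEN square_integrable_integrable]
  then show ?thesis
    by (simp add: centred_product_def distrib_left add_divide_distrib)
qed

lemma centred_product_diff_right:
  assumes "square_integrable M u" "square_integrable M v" "square_integrable M w"
  shows "centred_product M u (\<lambda>x. v x - w x) = centred_product M u v - centred_product M u w"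
proof -
  note square_integrable_mult_integrable[OF assms(1,2)] square_integrable_mult_integrable[OF assms(1,3)]
    assms[THEN square_integrable_integrable]
  then show ?thesis
    by (simp add: centred_product_def right_diff_distrib diff_divide_distrib)
qed

lemma centred_product_self:
  assumes "square_integrable M u" and pos: "measure M (space M) > 0"
  shows "centred_product M u u = (\<integral>x. (u x - (\<integral>x. u x \<partial>M) / measure M (space M))\<^sup>2 \<partial>M)"
proof -
  define m I where "m = measure M (space M)" and "I = (\<integral>x. u x \<partial>M)"
  have "(\<integral>x. (u x - I / m)\<^sup>2 \<partial>M) = (\<integral>x. u x * u x - 2 * (I / m) * u x + (I / m)\<^sup>2 \<partial>M)"
    by (simp add: power2_eq_square algebra_simps)
  also have "\<dots> = (\<integral>x. u x * u x \<partial>M) - 2 * (I / m) * I + m * (I / m)\<^sup>2"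
    using square_integrable_mult_integrable[OF assms(1,1)] square_integrable_integrable[OF assms(1)]
    by (simp add: I_def m_def)
  also have "\<dots> = centred_product M u u"
    using pos by (simp add: centred_product_def I_def[symmetric] m_def[symmetric] power2_eq_square field_simps)
  finally show ?thesis
    by (simp add: m_def I_def)
qed

lemma centred_product_self_eq_0:
  assumes "square_integrable M u" and pos: "measure M (space M) > 0" and "centred_product M u u = 0"
  shows "AE x in M. u x = (\<integral>x. u x \<partial>M) / measure M (space M)"
proof -
  define c where "c = (\<integral>x. u x \<partial>M) / measure M (space M)"
  have "integrable M (\<lambda>x. (u x - c)\<^sup>2)"
    using square_integrable_diff[OF assms(1) square_integrable_const] by (simp add: square_integrable_def)
  moreover have "(\<integral>x. (u x - c)\<^sup>2 \<partial>M) = 0"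
    using assms centred_product_self[OF assms(1,2)] by (simp add: c_def)
  ultimately have "AE x in M. (u x - c)\<^sup>2 = 0"
    by (subst (asm) integral_nonneg_eq_0_iff_AE) auto
  then show ?thesis
    unfolding c_def by eventually_elim simp
qed

text \<open>The Cauchy-Schwarz inequality against the constant \<open>1\<close>, read off from the nonnegativity of the
  variance.\<close>

lemma power2_integral_le:
  assumes "square_integrable M u"
  shows "(\<integral>x. u x \<partial>M)\<^sup>2 \<le> measure M (space M) * (\<integral>x. (u x)\<^sup>2 \<partial>M)"
proof (cases "measure M (space M) = 0")
  case True
  then have "emeasure M (space M) = 0"
    by (simp add: emeasure_eq_measure)
  then have "AE x in M. u x = 0"
    by (intro AE_I[of _ _ "space M"]) auto
  then have "(\<integral>x. u x \<partial>M) = 0"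
    by (rule integral_eq_zero_AE)
  then show ?thesis
    using True by simp
next
  case False
  then have pos: "measure M (space M) > 0"
    by (simp add: zero_less_measure_iff)
  have "0 \<le> centred_product M u u"
    unfolding centred_product_self[OF assms pos] by simp
  then show ?thesis
    using pos by (simp add: centred_product_def power2_eq_square field_simps)
qed

end

section \<open>Bayes spaces through logarithms of densities\<close>

context sigma_finite_measure
begin

lemma bayes_measures_absolutely_continuous:
  "\<mu> \<in> bayes_measures M \<Longrightarrow> absolutely_continuous M \<mu>"
  by (simp add: bayes_measures_def absolutely_continuous_def)

text \<open>The zero set of the derivative is a null set of \<open>\<mu>\<close>, hence of \<open>M\<close>, since both measures have the same
  null sets. This makes the logarithm of a density meaningful.\<close>

lemma real_density_pos:
  assumes "\<mu> \<in> bayes_measures M"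
  shows "AE x in M. 0 < real_density M \<mu> x"
proof -
  have \<mu>: "sets \<mu> = sets M" "sigma_finite_measure \<mu>" "null_sets \<mu> = null_sets M"
    using assms by (auto simp: bayes_measures_def)
  note ac = bayes_measures_absolutely_continuous[OF assms]
  have fin: "AE x in M. RN_deriv M \<mu> x \<noteq> \<infinity>"
    by (rule RN_deriv_finite) (use \<mu> ac in auto)
  define Z where "Z = {x \<in> space M. RN_deriv M \<mu> x = 0}"
  have Z: "Z \<in> sets M"
    unfolding Z_def by measurable
  then have "Z \<in> null_sets (density M (RN_deriv M \<mu>))"
    by (subst null_sets_density_iff) (auto simp: Z_def)
  then have "Z \<in> null_sets M"
    using density_RN_deriv[OF ac \<mu>(1)] \<mu>(3) by simp
  then have "AE x in M. x \<notin> Z"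
    by (rule AE_not_in)
  with fin AE_space show ?thesis
    by eventually_elim (auto simp: Z_def real_density_def enn2real_positive_iff less_top zero_less_iff_neq_zero)
qed

text \<open>Together with the next two lemmas, this makes \<open>h \<mapsto> exp h\<close> a parametrisation of \<^term>\<open>bayes_measures M\<close>
  by the measurable functions up to equality almost everywhere, inverse to taking the logarithm of
  the density.\<close>

lemma density_exp_ln_real_density:
  assumes "\<mu> \<in> bayes_measures M"
  shows "density M (\<lambda>x. ennreal (exp (ln (real_density M \<mu> x)))) = \<mu>"
proof -
  have \<mu>: "sets \<mu> = sets M" "sigma_finite_measure \<mu>"
    using assms by (auto simp: bayes_measures_def)
  note ac = bayes_measures_absolutely_continuous[OF assms]
  have fin: "AE x in M. RN_deriv M \<mu> x \<noteq> \<infinity>"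
    by (rule RN_deriv_finite) (use \<mu> ac in auto)
  have "density M (\<lambda>x. ennreal (exp (ln (real_density M \<mu> x)))) = density M (RN_deriv M \<mu>)"
  proof (rule density_cong)
    show "AE x in M. ennreal (exp (ln (real_density M \<mu> x))) = RN_deriv M \<mu> x"
      using real_density_pos[OF assms] fin
      by eventually_elim (simp add: real_density_def less_top)
  qed (simp_all add: real_density_def)
  then show ?thesis
    using density_RN_deriv[OF ac \<mu>(1)] by simp
qed

lemma density_exp_in_bayes_measures:
  assumes [measurable]: "h \<in> borel_measurable M"
  shows "density M (\<lambda>x. ennreal (exp (h x))) \<in> bayes_measures M"
proof -
  have "sigma_finite_measure (density M (\<lambda>x. ennreal (exp (h x))))"
    by (subst sigma_finite_iff_density_finite) auto
  moreover have "A \<in> null_sets (density M (\<lambda>x. ennreal (exp (h x)))) \<longleftrightarrow> A \<in> null_sets M" for A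
    by (subst null_sets_density_iff) (auto simp: AE_iff_null_sets dest: AE_not_in)
  ultimately show ?thesis
    by (auto simp: bayes_measures_def)
qed

lemma ln_real_density_density_exp:
  assumes [measurable]: "h \<in> borel_measurable M"
  shows "AE x in M. ln (real_density M (density M (\<lambda>x. ennreal (exp (h x)))) x) = h x"
proof -
  have "AE x in M. ennreal (exp (h x)) = RN_deriv M (density M (\<lambda>x. ennreal (exp (h x)))) x"
    by (rule RN_deriv_unique) auto
  then show ?thesis
    by eventually_elim (metis enn2real_ennreal exp_ge_zero ln_exp real_density_def)
qed

lemma prop_rel_iff_ln_real_density:
  assumes "\<mu> \<in> bayes_measures M" "\<nu> \<in> bayes_measures M"
  shows "(\<mu>, \<nu>) \<in> prop_rel M \<longleftrightarrow>
    (\<exists>c. AE x in M. ln (real_density M \<mu> x) = ln (real_density M \<nu> x) + c)"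
proof
  assume "(\<mu>, \<nu>) \<in> prop_rel M"
  then obtain c :: real where c: "0 < c" "AE x in M. real_density M \<mu> x = c * real_density M \<nu> x"
    by (auto simp: prop_rel_def)
  have "AE x in M. ln (real_density M \<mu> x) = ln (real_density M \<nu> x) + ln c"
    using c(2) real_density_pos[OF assms(2)] by eventually_elim (simp add: ln_mult_pos c(1))
  then show "\<exists>c. AE x in M. ln (real_density M \<mu> x) = ln (real_density M \<nu> x) + c" ..
next
  assume "\<exists>c. AE x in M. ln (real_density M \<mu> x) = ln (real_density M \<nu> x) + c"
  then obtain c where c: "AE x in M. ln (real_density M \<mu> x) = ln (real_density M \<nu> x) + c" ..
  have "AE x in M. real_density M \<mu> x = exp c * real_density M \<nu> x"
    using c real_density_pos[OF assms(1)] real_density_pos[OF assms(2)]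
    by eventually_elim (metis exp_add exp_ln mult.commute)
  then show "(\<mu>, \<nu>) \<in> prop_rel M"
    using assms unfolding prop_rel_def by (auto intro!: exI[of _ "exp c"])
qed

end

text \<open>A centred log-ratio transform without the centring: the constant is left to the choice made in
  \<^const>\<open>bayes_density\<close>.\<close>

definition log_density :: "'a measure \<Rightarrow> 'a measure set \<Rightarrow> 'a \<Rightarrow> real" where
  "log_density L F x = ln (bayes_density L F x)"

lemma log_density_measurable [measurable]: "log_density L F \<in> borel_measurable L"
  unfolding log_density_def[abs_def] bayes_density_def real_density_def[abs_def] by measurable

lemma bayes_L2_iff:
  "F \<in> bayes_L2 L \<longleftrightarrow> F \<in> bayes_space L \<and> square_integrable L (log_density L F)"
  by (simp add: bayes_L2_def square_integrable_def log_density_def)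

lemma bayes_class_in_bayes_space: "\<mu> \<in> bayes_measures L \<Longrightarrow> bayes_class L \<mu> \<in> bayes_space L"
  by (simp add: bayes_class_def bayes_space_def quotientI)

lemma bayes_space_representative:
  assumes "F \<in> bayes_space L"
  shows "(SOME \<mu>. \<mu> \<in> F) \<in> bayes_measures L" "bayes_class L (SOME \<mu>. \<mu> \<in> F) = F"
proof -
  obtain \<nu> where \<nu>: "F = prop_rel L `` {\<nu>}" "\<nu> \<in> bayes_measures L"
    using assms unfolding bayes_space_def by (rule quotientE)
  then have "\<nu> \<in> F"
    using equiv_class_self[OF equiv_prop_rel] by simp
  then have "(SOME \<mu>. \<mu> \<in> F) \<in> F"
    by (rule someI[of "\<lambda>\<mu>. \<mu> \<in> F"])
  then have rel: "(\<nu>, SOME \<mu>. \<mu> \<in> F) \<in> prop_rel L"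
    using \<nu>(1) by simp
  then show "(SOME \<mu>. \<mu> \<in> F) \<in> bayes_measures L"
    by (simp add: prop_rel_def)
  show "bayes_class L (SOME \<mu>. \<mu> \<in> F) = F"
    unfolding bayes_class_def
    by (rule trans[OF equiv_class_eq[OF equiv_prop_rel rel, symmetric] \<nu>(1)[symmetric]])
qed

context sigma_finite_measure
begin

lemma bayes_density_pos:
  "F \<in> bayes_space M \<Longrightarrow> AE x in M. 0 < bayes_density M F x"
  using real_density_pos[OF bayes_space_representative(1)] by (simp add: bayes_density_def)

lemma log_density_bayes_class:
  assumes "\<mu> \<in> bayes_measures M"
  shows "\<exists>c. AE x in M. log_density M (bayes_class M \<mu>) x = ln (real_density M \<mu> x) + c"
proof -
  define \<nu> where "\<nu> = (SOME \<nu>. \<nu> \<in> bayes_class M \<mu>)"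
  have \<nu>: "\<nu> \<in> bayes_measures M" "bayes_class M \<nu> = bayes_class M \<mu>"
    using bayes_space_representative[OF bayes_class_in_bayes_space[OF assms]] by (simp_all add: \<nu>_def)
  then have "(\<nu>, \<mu>) \<in> prop_rel M"
    using assms eq_equiv_class_iff[OF equiv_prop_rel, of \<nu> M \<mu>] by (simp add: bayes_class_def)
  then show ?thesis
    using prop_rel_iff_ln_real_density[OF \<nu>(1) assms]
    by (simp add: log_density_def bayes_density_def \<nu>_def)
qed

text \<open>Proportionality of densities is equality of their logarithms up to an additive constant.\<close>

lemma bayes_space_eqI:
  assumes "F \<in> bayes_space M" "G \<in> bayes_space M"
    and "AE x in M. log_density M F x = log_density M G x + c"
  shows "F = G"
proof -
  define \<mu> \<nu> where "\<mu> = (SOME \<mu>. \<mu> \<in> F)" and "\<nu> = (SOME \<mu>. \<mu> \<in> G)"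
  have \<mu>: "\<mu> \<in> bayes_measures M" "bayes_class M \<mu> = F"
    and \<nu>: "\<nu> \<in> bayes_measures M" "bayes_class M \<nu> = G"
    using bayes_space_representative assms(1,2) by (simp_all add: \<mu>_def \<nu>_def)
  have "(\<mu>, \<nu>) \<in> prop_rel M"
    using prop_rel_iff_ln_real_density[OF \<mu>(1) \<nu>(1)] assms(3)
    by (auto simp: log_density_def bayes_density_def \<mu>_def \<nu>_def)
  then show ?thesis
    using equiv_class_eq[OF equiv_prop_rel, of \<mu> \<nu>] \<mu>(2) \<nu>(2) by (simp add: bayes_class_def)
qed

text \<open>The common source of the logarithms of sums, multiples and margins, all of which are classes of an
  explicit density. That density is only almost everywhere of exponential form, because the chosen
  densities may vanish on a null set.\<close>

lemma class_of_density_log: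
  assumes [measurable]: "f \<in> borel_measurable M" "h \<in> borel_measurable M"
    and "AE x in M. f x = exp (h x)"
  shows "class_of_density M f \<in> bayes_space M"
    and "\<exists>c. AE x in M. log_density M (class_of_density M f) x = h x + c"
proof -
  have eq: "class_of_density M f = bayes_class M (density M (\<lambda>x. ennreal (exp (h x))))"
    unfolding class_of_density_def
    by (intro arg_cong[of _ _ "bayes_class M"] density_cong) (use assms(3) in auto)
  note mem = density_exp_in_bayes_measures[OF assms(2)]
  show "class_of_density M f \<in> bayes_space M"
    unfolding eq by (rule bayes_class_in_bayes_space[OF mem])
  from log_density_bayes_class[OF mem] obtain c where
    "AE x in M. log_density M (class_of_density M f) x =
      ln (real_density M (density M (\<lambda>x. ennreal (exp (h x)))) x) + c"
    unfolding eq by blast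
  then have "AE x in M. log_density M (class_of_density M f) x = h x + c"
    using ln_real_density_density_exp[OF assms(2)] by eventually_elim simp
  then show "\<exists>c. AE x in M. log_density M (class_of_density M f) x = h x + c" ..
qed

lemma bayes_add_log:
  assumes "F \<in> bayes_space M" "G \<in> bayes_space M"
  shows "bayes_add M F G \<in> bayes_space M"
    and "\<exists>c. AE x in M. log_density M (bayes_add M F G) x = log_density M F x + log_density M G x + c"
proof -
  have [measurable]: "bayes_density M H \<in> borel_measurable M" for H
    unfolding bayes_density_def real_density_def[abs_def] by measurable
  have ae: "AE x in M. bayes_density M F x * bayes_density M G x =
      exp (log_density M F x + log_density M G x)"
    using bayes_density_pos[OF assms(1)] bayes_density_pos[OF assms(2)]
    by eventually_elim (simp add: log_density_def exp_add)
  show "bayes_add M F G \<in> bayes_space M"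
    unfolding bayes_add_def by (rule class_of_density_log(1)[OF _ _ ae]) measurable
  show "\<exists>c. AE x in M. log_density M (bayes_add M F G) x = log_density M F x + log_density M G x + c"
    unfolding bayes_add_def by (rule class_of_density_log(2)[OF _ _ ae]) measurable
qed

lemma bayes_scale_log:
  assumes "F \<in> bayes_space M"
  shows "bayes_scale M \<alpha> F \<in> bayes_space M"
    and "\<exists>c. AE x in M. log_density M (bayes_scale M \<alpha> F) x = \<alpha> * log_density M F x + c"
proof -
  have [measurable]: "bayes_density M F \<in> borel_measurable M"
    unfolding bayes_density_def real_density_def[abs_def] by measurable
  have ae: "AE x in M. bayes_density M F x powr \<alpha> = exp (\<alpha> * log_density M F x)"
    using bayes_density_pos[OF assms] by eventually_elim (simp add: log_density_def powr_def)
  show "bayes_scale M \<alpha> F \<in> bayes_space M"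
    unfolding bayes_scale_def by (rule class_of_density_log(1)[OF _ _ ae]) measurable
  show "\<exists>c. AE x in M. log_density M (bayes_scale M \<alpha> F) x = \<alpha> * log_density M F x + c"
    unfolding bayes_scale_def by (rule class_of_density_log(2)[OF _ _ ae]) measurable
qed

lemma bayes_diff_log:
  assumes "F \<in> bayes_space M" "G \<in> bayes_space M"
  shows "bayes_diff M F G \<in> bayes_space M"
    and "\<exists>c. AE x in M. log_density M (bayes_diff M F G) x = log_density M F x - log_density M G x + c"
proof -
  note scale = bayes_scale_log[OF assms(2), of "-1"]
  note add = bayes_add_log[OF assms(1) scale(1)]
  show "bayes_diff M F G \<in> bayes_space M"
    using add(1) by (simp add: bayes_diff_def)
  obtain c where c: "AE x in M. log_density M (bayes_scale M (-1) G) x = -1 * log_density M G x + c"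
    using scale(2) by blast
  obtain d where d: "AE x in M. log_density M (bayes_diff M F G) x =
      log_density M F x + log_density M (bayes_scale M (-1) G) x + d"
    using add(2) unfolding bayes_diff_def by blast
  have "AE x in M. log_density M (bayes_diff M F G) x = log_density M F x - log_density M G x + (c + d)"
    using c d by eventually_elim simp
  then show "\<exists>c. AE x in M. log_density M (bayes_diff M F G) x = log_density M F x - log_density M G x + c" ..
qed

end

context finite_measure
begin

lemma bayes_class_in_bayes_L2_iff:
  assumes "\<mu> \<in> bayes_measures M"
  shows "bayes_class M \<mu> \<in> bayes_L2 M \<longleftrightarrow> square_integrable M (\<lambda>x. ln (real_density M \<mu> x))"
proof -
  obtain c where c: "AE x in M. log_density M (bayes_class M \<mu>) x = ln (real_density M \<mu> x) + c"
    using log_density_bayes_class[OF assms] by blast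
  then have c': "AE x in M. ln (real_density M \<mu> x) = log_density M (bayes_class M \<mu>) x + (- c)"
    by eventually_elim simp
  have [measurable]: "(\<lambda>x. ln (real_density M \<mu> x)) \<in> borel_measurable M"
    unfolding real_density_def by measurable
  show ?thesis
    unfolding bayes_L2_iff
    using bayes_class_in_bayes_space[OF assms] square_integrable_up_to_const[OF _ _ c]
      square_integrable_up_to_const[OF _ _ c'] by auto
qed

text \<open>Differences of logarithms remove the unknown constants, so that almost everywhere the integrand is
  \<open>(u(x) - u(y)) (v(x) - v(y))\<close>. Expanding the product and integrating gives
  \<open>2 M(\<Omega>) \<integral>uv - 2 (\<integral>u)(\<integral>v)\<close>.\<close>

lemma bayes_inner_eq_centred_product:
  assumes "F \<in> bayes_space M" "G \<in> bayes_space M"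
    and u: "square_integrable M u" "AE x in M. log_density M F x = u x + c"
    and v: "square_integrable M v" "AE x in M. log_density M G x = v x + d"
    and pos: "measure M (space M) > 0"
  shows "bayes_inner M F G = centred_product M u v"
proof -
  define m U V W where "m = measure M (space M)" and "U = (\<integral>x. u x \<partial>M)" and "V = (\<integral>x. v x \<partial>M)"
    and "W = (\<integral>x. u x * v x \<partial>M)"
  note int [simp] = square_integrable_mult_integrable[OF u(1) v(1)]
    square_integrable_integrable[OF u(1)] square_integrable_integrable[OF v(1)]
  have [measurable]: "u \<in> borel_measurable M" "v \<in> borel_measurable M"
    using u v by (simp_all add: square_integrable_def)
  have [measurable]: "bayes_density M H \<in> borel_measurable M" for H
    unfolding bayes_density_def real_density_def[abs_def] by measurable
  have good: "AE x in M. 0 < bayes_density M F x \<and> ln (bayes_density M F x) = u x + c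
      \<and> 0 < bayes_density M G x \<and> ln (bayes_density M G x) = v x + d"
    using bayes_density_pos[OF assms(1)] bayes_density_pos[OF assms(2)] u(2) v(2)
    unfolding log_density_def by eventually_elim simp
  have inner: "AE y in M. (\<integral>x. ln (bayes_density M F x / bayes_density M F y) *
      ln (bayes_density M G x / bayes_density M G y) \<partial>M) = W - u y * V - v y * U + m * (u y * v y)"
    using good
  proof eventually_elim
    case y: (elim y)
    have "AE x in M. ln (bayes_density M F x / bayes_density M F y) *
      ln (bayes_density M G x / bayes_density M G y) = (u x - u y) * (v x - v y)"
      using good by eventually_elim (use y in \<open>simp add: ln_div\<close>)
    then have "(\<integral>x. ln (bayes_density M F x / bayes_density M F y) *
      ln (bayes_density M G x / bayes_density M G y) \<partial>M) = (\<integral>x. (u x - u y) * (v x - v y) \<partial>M)"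
      by (intro integral_cong_AE) auto
    also have "\<dots> = (\<integral>x. u x * v x - u y * v x - v y * u x + u y * v y \<partial>M)"
      by (simp add: algebra_simps)
    also have "\<dots> = W - u y * V - v y * U + m * (u y * v y)"
      by (simp add: U_def V_def W_def m_def)
    finally show ?case .
  qed
  have "(\<integral>y. \<integral>x. ln (bayes_density M F x / bayes_density M F y) *
      ln (bayes_density M G x / bayes_density M G y) \<partial>M \<partial>M) =
      (\<integral>y. W - u y * V - v y * U + m * (u y * v y) \<partial>M)"
    by (intro integral_cong_AE inner) auto
  also have "\<dots> = m * W - U * V - V * U + m * W"
    by (simp add: U_def V_def W_def m_def)
  finally show ?thesis
    using pos by (simp add: bayes_inner_def centred_product_def U_def[symmetric] V_def[symmetric]
        W_def[symmetric] m_def[symmetric] field_simps)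
qed

lemma bayes_inner_diff_eq_centred_product:
  assumes F: "F \<in> bayes_L2 M"
    and P: "P \<in> bayes_space M" and p: "square_integrable M p" "AE x in M. log_density M P x = p x + c"
    and G: "G \<in> bayes_space M" and g: "square_integrable M g" "AE x in M. log_density M G x = g x + d"
    and pos: "measure M (space M) > 0"
  shows "bayes_inner M (bayes_diff M F P) G = centred_product M (\<lambda>x. log_density M F x - p x) g"
proof -
  have F': "F \<in> bayes_space M" "square_integrable M (log_density M F)"
    using F by (simp_all add: bayes_L2_iff)
  obtain e where "AE x in M. log_density M (bayes_diff M F P) x = log_density M F x - log_density M P x + e"
    using bayes_diff_log(2)[OF F'(1) P] by blast
  with p(2) have "AE x in M. log_density M (bayes_diff M F P) x = (log_density M F x - p x) + (e - c)"
    by eventually_elim simp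
  then show ?thesis
    by (rule bayes_inner_eq_centred_product[OF bayes_diff_log(1)[OF F'(1) P] G
          square_integrable_diff[OF F'(2) p(1)] _ g pos])
qed

text \<open>If \<open>P\<close> and \<open>Q\<close> are projections with logarithms \<open>p\<close> and \<open>q\<close>, then
  \<open>p - q\<close> is orthogonal to all of \<open>S\<close>, in particular to \<open>p\<close> and to \<open>q\<close>, and so to itself.\<close>

lemma bayes_orthogonal_projection_unique:
  assumes S: "S \<subseteq> bayes_L2 M" and F: "F \<in> bayes_L2 M" and pos: "measure M (space M) > 0"
    and P: "bayes_orthogonal_projection M S F P" and Q: "bayes_orthogonal_projection M S F Q"
  shows "P = Q"
proof -
  define u p q where "u = log_density M F" and "p = log_density M P" and "q = log_density M Q"
  have PS: "P \<in> S" and QS: "Q \<in> S"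
    using P Q by (auto simp: bayes_orthogonal_projection_def)
  have sq: "square_integrable M u" "square_integrable M p" "square_integrable M q"
    and PQ: "P \<in> bayes_space M" "Q \<in> bayes_space M"
    using F PS QS S by (auto simp: bayes_L2_iff u_def p_def q_def)
  have diff: "square_integrable M (\<lambda>x. p x - q x)"
    by (rule square_integrable_diff[OF sq(2,3)])
  have orth: "centred_product M (\<lambda>x. u x - log_density M R x) (log_density M G) = 0"
    if "bayes_orthogonal_projection M S F R" "G \<in> S" for R G
  proof -
    have R: "R \<in> S" "bayes_inner M (bayes_diff M F R) G = 0"
      using that by (auto simp: bayes_orthogonal_projection_def)
    then have RG: "R \<in> bayes_space M" "square_integrable M (log_density M R)"
      "G \<in> bayes_space M" "square_integrable M (log_density M G)"
      using S that(2) by (auto simp: bayes_L2_iff)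
    have "AE x in M. log_density M H x = log_density M H x + 0" for H
      by simp
    from bayes_inner_diff_eq_centred_product[OF F RG(1,2) this RG(3,4) this pos] R(2) show ?thesis
      by (simp add: u_def)
  qed
  have zero: "centred_product M (\<lambda>x. p x - q x) (log_density M G) = 0" if "G \<in> S" for G
  proof -
    have G: "square_integrable M (log_density M G)"
      using S that by (auto simp: bayes_L2_iff)
    have "centred_product M u (log_density M G) - centred_product M p (log_density M G) = 0"
      "centred_product M u (log_density M G) - centred_product M q (log_density M G) = 0"
      using orth[OF P that] orth[OF Q that] centred_product_diff_left[OF sq(1,2) G]
        centred_product_diff_left[OF sq(1,3) G] by (simp_all add: p_def q_def)
    then show ?thesis
      using centred_product_diff_left[OF sq(2,3) G] by simp
  qed
  have "centred_product M (\<lambda>x. p x - q x) (\<lambda>x. p x - q x) = 0"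
    using centred_product_diff_right[OF diff sq(2,3)] zero[OF PS] zero[OF QS] by (simp add: p_def q_def)
  from centred_product_self_eq_0[OF diff pos this]
  have "AE x in M. log_density M P x = log_density M Q x + (\<integral>x. p x - q x \<partial>M) / measure M (space M)"
    by eventually_elim (simp add: p_def q_def)
  then show ?thesis
    by (rule bayes_space_eqI[OF PQ])
qed

end

section \<open>Orthogonality to functions of one coordinate\<close>

locale pair_finite_measure = M1: finite_measure M1 + M2: finite_measure M2
  for M1 :: "'a measure" and M2 :: "'b measure"

sublocale pair_finite_measure \<subseteq> P: pair_sigma_finite M1 M2 ..

sublocale pair_finite_measure \<subseteq> M: finite_measure "M1 \<Otimes>\<^sub>M M2"
  by (rule finite_measure_pair_measure) unfold_locales

context pair_finite_measure
begin

lemma measure_space_pair: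
  "measure (M1 \<Otimes>\<^sub>M M2) (space (M1 \<Otimes>\<^sub>M M2)) = measure M1 (space M1) * measure M2 (space M2)"
  by (simp add: space_pair_measure measure_def M2.emeasure_pair_measure_Times enn2real_mult)

text \<open>On almost every section the square of the integral is at most \<open>M2(\<Omega>)\<close> times the integral of the
  square, and the latter is an integrable function of \<open>x\<close>.\<close>

lemma square_integrable_section_integral:
  assumes "square_integrable (M1 \<Otimes>\<^sub>M M2) u"
  shows "square_integrable M1 (\<lambda>x. \<integral>y. u (x, y) \<partial>M2)"
proof -
  have [measurable]: "u \<in> borel_measurable (M1 \<Otimes>\<^sub>M M2)"
    and int: "integrable (M1 \<Otimes>\<^sub>M M2) (\<lambda>z. (u z)\<^sup>2)"
    using assms by (simp_all add: square_integrable_def)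
  have "integrable M1 (\<lambda>x. (\<integral>y. u (x, y) \<partial>M2)\<^sup>2)"
  proof (rule Bochner_Integration.integrable_bound)
    show "integrable M1 (\<lambda>x. measure M2 (space M2) * (\<integral>y. (u (x, y))\<^sup>2 \<partial>M2))"
      using P.integrable_fst'[OF int] by simp
    have "AE x in M1. integrable M2 (\<lambda>y. (u (x, y))\<^sup>2)"
      using P.AE_integrable_fst'[OF int] .
    with AE_space show "AE x in M1. norm ((\<integral>y. u (x, y) \<partial>M2)\<^sup>2)
        \<le> norm (measure M2 (space M2) * (\<integral>y. (u (x, y))\<^sup>2 \<partial>M2))"
    proof eventually_elim
      case (elim x)
      then have "square_integrable M2 (\<lambda>y. u (x, y))"
        by (auto simp: square_integrable_def)
      from M2.power2_integral_le[OF this] show ?case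
        by (auto simp: abs_of_nonneg)
    qed
  qed simp
  then show ?thesis
    by (simp add: square_integrable_def)
qed

lemma square_integrable_fst:
  assumes "square_integrable M1 g"
  shows "square_integrable (M1 \<Otimes>\<^sub>M M2) (\<lambda>(x, y). g x)"
    and "(\<integral>z. (\<lambda>(x, y). g x) z \<partial>(M1 \<Otimes>\<^sub>M M2)) = measure M2 (space M2) * (\<integral>x. g x \<partial>M1)"
proof -
  have [measurable]: "g \<in> borel_measurable M1" and int: "integrable M1 (\<lambda>x. (g x)\<^sup>2)"
    using assms by (simp_all add: square_integrable_def)
  have "integrable (M1 \<Otimes>\<^sub>M M2) (\<lambda>z. (case z of (x, y) \<Rightarrow> g x)\<^sup>2)"
    by (rule P.Fubini_integrable) (use int in auto)
  then show sq: "square_integrable (M1 \<Otimes>\<^sub>M M2) (\<lambda>(x, y). g x)"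
    by (simp add: square_integrable_def)
  show "(\<integral>z. (\<lambda>(x, y). g x) z \<partial>(M1 \<Otimes>\<^sub>M M2)) = measure M2 (space M2) * (\<integral>x. g x \<partial>M1)"
    using P.integral_fst'[OF M.square_integrable_integrable[OF sq]] by simp
qed

text \<open>By Fubini \<open>\<integral>r(x,y) g(x) = C \<integral>g\<close>, while \<open>\<integral>r = M1(\<Omega>) C\<close> and \<open>g\<close> integrates over the product to
  \<open>M2(\<Omega>) \<integral>g\<close>; the two terms of the centred product cancel.\<close>

lemma centred_product_fst_eq_0:
  assumes r: "square_integrable (M1 \<Otimes>\<^sub>M M2) r" and g: "square_integrable M1 g"
    and C: "AE x in M1. (\<integral>y. r (x, y) \<partial>M2) = C"
    and pos: "measure M1 (space M1) > 0" "measure M2 (space M2) > 0"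
  shows "centred_product (M1 \<Otimes>\<^sub>M M2) r (\<lambda>(x, y). g x) = 0"
proof -
  have [measurable]: "r \<in> borel_measurable (M1 \<Otimes>\<^sub>M M2)" "g \<in> borel_measurable M1"
    using r g by (simp_all add: square_integrable_def)
  have "(\<integral>z. r z \<partial>(M1 \<Otimes>\<^sub>M M2)) = (\<integral>x. \<integral>y. r (x, y) \<partial>M2 \<partial>M1)"
    using P.integral_fst'[OF M.square_integrable_integrable[OF r]] by simp
  also have "\<dots> = (\<integral>x. C \<partial>M1)"
    by (rule integral_cong_AE) (use C in auto)
  finally have r_int: "(\<integral>z. r z \<partial>(M1 \<Otimes>\<^sub>M M2)) = measure M1 (space M1) * C"
    by simp
  have "(\<integral>z. r z * (\<lambda>(x, y). g x) z \<partial>(M1 \<Otimes>\<^sub>M M2)) = (\<integral>x. \<integral>y. r (x, y) * g x \<partial>M2 \<partial>M1)"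
    using P.integral_fst'[OF square_integrable_mult_integrable[OF r square_integrable_fst(1)[OF g]]] by simp
  also have "\<dots> = (\<integral>x. C * g x \<partial>M1)"
    by (rule integral_cong_AE) (use C in auto)
  finally have "(\<integral>z. r z * (\<lambda>(x, y). g x) z \<partial>(M1 \<Otimes>\<^sub>M M2)) = C * (\<integral>x. g x \<partial>M1)"
    by simp
  then show ?thesis
    unfolding centred_product_def r_int square_integrable_fst(2)[OF g] measure_space_pair
    using pos by simp
qed

lemma square_integrable_swap:
  assumes "square_integrable (M1 \<Otimes>\<^sub>M M2) u"
  shows "square_integrable (M2 \<Otimes>\<^sub>M M1) (\<lambda>(y, x). u (x, y))"
proof -
  have [measurable]: "u \<in> borel_measurable (M1 \<Otimes>\<^sub>M M2)"
    and int: "integrable (M1 \<Otimes>\<^sub>M M2) (\<lambda>z. (u z)\<^sup>2)"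
    using assms by (simp_all add: square_integrable_def)
  have "(\<lambda>(y, x). u (x, y)) \<in> borel_measurable (M2 \<Otimes>\<^sub>M M1)"
    by measurable
  moreover have "integrable (M2 \<Otimes>\<^sub>M M1) (\<lambda>z. (case z of (y, x) \<Rightarrow> u (x, y))\<^sup>2)"
    using P.integrable_product_swap[OF int] by (simp add: case_prod_unfold)
  ultimately show ?thesis
    by (simp add: square_integrable_def)
qed

text \<open>Exchanging the factors carries orthogonality to functions of the first coordinate over to functions
  of the second.\<close>

lemma centred_product_swap:
  assumes [measurable]: "u \<in> borel_measurable (M1 \<Otimes>\<^sub>M M2)" "v \<in> borel_measurable (M1 \<Otimes>\<^sub>M M2)"
  shows "centred_product (M2 \<Otimes>\<^sub>M M1) (\<lambda>(y, x). u (x, y)) (\<lambda>(y, x). v (x, y)) =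
    centred_product (M1 \<Otimes>\<^sub>M M2) u v"
proof -
  have swap: "(\<integral>(y, x). f (x, y) \<partial>(M2 \<Otimes>\<^sub>M M1)) = (\<integral>z. f z \<partial>(M1 \<Otimes>\<^sub>M M2))"
    if "f \<in> borel_measurable (M1 \<Otimes>\<^sub>M M2)" for f :: "'a \<times> 'b \<Rightarrow> real"
    using P.integral_product_swap[OF that] .
  interpret S: pair_finite_measure M2 M1 ..
  have "(\<integral>z. (case z of (y, x) \<Rightarrow> u (x, y)) * (case z of (y, x) \<Rightarrow> v (x, y)) \<partial>(M2 \<Otimes>\<^sub>M M1)) =
      (\<integral>z. u z * v z \<partial>(M1 \<Otimes>\<^sub>M M2))"
    using swap[of "\<lambda>z. u z * v z"] by (simp add: case_prod_unfold)
  then show ?thesis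
    by (simp add: centred_product_def swap S.measure_space_pair measure_space_pair mult.commute)
qed

text \<open>Subtracting the section mean leaves a section integral that depends on \<open>b\<close> alone, and so not on
  \<open>x\<close>. An arbitrary \<open>b\<close> lets either section mean take its place after an exchange of the factors.\<close>

lemma section_integral_residual:
  assumes u: "square_integrable (M1 \<Otimes>\<^sub>M M2) u" and b: "square_integrable M2 b"
    and pos: "measure M2 (space M2) > 0"
  shows "AE x in M1. (\<integral>y. u (x, y) - 1 / measure M2 (space M2) * (\<integral>z. u (x, z) \<partial>M2) - b y \<partial>M2) =
    - (\<integral>y. b y \<partial>M2)"
  using P.AE_integrable_fst'[OF M.square_integrable_integrable[OF u]]
proof eventually_elim
  case (elim x)
  then show ?case
    using M2.square_integrable_integrable[OF b] pos by simp
qed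

lemma centred_product_residual_fst:
  assumes u: "square_integrable (M1 \<Otimes>\<^sub>M M2) u" and b: "square_integrable M2 b"
    and r: "square_integrable (M1 \<Otimes>\<^sub>M M2) r" and g: "square_integrable M1 g"
    and eq: "\<And>x y. r (x, y) = u (x, y) - 1 / measure M2 (space M2) * (\<integral>z. u (x, z) \<partial>M2) - b y"
    and pos: "measure M1 (space M1) > 0" "measure M2 (space M2) > 0"
  shows "centred_product (M1 \<Otimes>\<^sub>M M2) r (\<lambda>(x, y). g x) = 0"
  using section_integral_residual[OF u b pos(2)]
  unfolding eq[symmetric] by (rule centred_product_fst_eq_0[OF r g _ pos])

lemma square_integrable_section_mean1:
  "square_integrable (M1 \<Otimes>\<^sub>M M2) u \<Longrightarrow>
    square_integrable M1 (\<lambda>x. 1 / measure M2 (space M2) * (\<integral>z. u (x, z) \<partial>M2))"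
  by (rule square_integrable_scale[OF square_integrable_section_integral])

lemma square_integrable_section_mean2:
  assumes "square_integrable (M1 \<Otimes>\<^sub>M M2) u"
  shows "square_integrable M2 (\<lambda>y. 1 / measure M1 (space M1) * (\<integral>z. u (z, y) \<partial>M1))"
proof -
  interpret S: pair_finite_measure M2 M1 ..
  show ?thesis
    using S.square_integrable_section_mean1[OF square_integrable_swap[OF assms]] by simp
qed

lemma square_integrable_snd:
  assumes "square_integrable M2 g"
  shows "square_integrable (M1 \<Otimes>\<^sub>M M2) (\<lambda>(x, y). g y)"
proof -
  interpret S: pair_finite_measure M2 M1 ..
  show ?thesis
    using S.square_integrable_swap[OF S.square_integrable_fst(1)[OF assms]] by simp
qed

lemma square_integrable_sum_of_coordinates:
  assumes "square_integrable M1 f" "square_integrable M2 g"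
  shows "square_integrable (M1 \<Otimes>\<^sub>M M2) (\<lambda>(x, y). f x + g y)"
  using square_integrable_add[OF square_integrable_fst(1)[OF assms(1)] square_integrable_snd[OF assms(2)]]
  by (simp add: case_prod_unfold)

text \<open>The residual treats both coordinates alike, so orthogonality to \<open>f(x)\<close> and to \<open>g(y)\<close> are the
  same statement on the product and on the product with its factors exchanged.\<close>

lemma residual_orthogonal:
  fixes u :: "'a \<times> 'b \<Rightarrow> real"
  defines "a \<equiv> \<lambda>x. 1 / measure M2 (space M2) * (\<integral>z. u (x, z) \<partial>M2)"
    and "b \<equiv> \<lambda>y. 1 / measure M1 (space M1) * (\<integral>z. u (z, y) \<partial>M1)"
  assumes u: "square_integrable (M1 \<Otimes>\<^sub>M M2) u"
    and f: "square_integrable M1 f" and g: "square_integrable M2 g"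
    and pos: "measure M1 (space M1) > 0" "measure M2 (space M2) > 0"
  shows "centred_product (M1 \<Otimes>\<^sub>M M2) (\<lambda>z. u z - (\<lambda>(x, y). a x + b y) z) (\<lambda>(x, y). f x + g y) = 0"
proof -
  interpret S: pair_finite_measure M2 M1 ..
  define r where "r = (\<lambda>z. u z - (\<lambda>(x, y). a x + b y) z)"
  have a: "square_integrable M1 a" and b: "square_integrable M2 b"
    unfolding a_def b_def by (fact square_integrable_section_mean1[OF u] square_integrable_section_mean2[OF u])+
  have r: "square_integrable (M1 \<Otimes>\<^sub>M M2) r"
    unfolding r_def by (rule square_integrable_diff[OF u square_integrable_sum_of_coordinates[OF a b]])
  have "centred_product (M1 \<Otimes>\<^sub>M M2) r (\<lambda>(x, y). f x) = 0"
    by (rule centred_product_residual_fst[OF u b r f _ pos]) (simp add: r_def a_def)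
  moreover have "centred_product (M2 \<Otimes>\<^sub>M M1) (\<lambda>(y, x). r (x, y)) (\<lambda>(y, x). g y) = 0"
    by (rule S.centred_product_residual_fst[OF square_integrable_swap[OF u] a
          square_integrable_swap[OF r] g _ pos(2,1)]) (simp add: r_def b_def)
  then have "centred_product (M1 \<Otimes>\<^sub>M M2) r (\<lambda>(x, y). g y) = 0"
    using centred_product_swap[of r "\<lambda>(x, y). g y"] r square_integrable_snd[OF g]
    by (simp add: square_integrable_def)
  ultimately show ?thesis
    using M.centred_product_add_right[OF r square_integrable_fst(1)[OF f] square_integrable_snd[OF g]]
    by (simp add: r_def case_prod_unfold)
qed

end

section \<open>The independence space and the independence part\<close>

context pair_finite_measure
begin

lemma pair_measure_density_exp:
  assumes [measurable]: "f \<in> borel_measurable M1" "g \<in> borel_measurable M2"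
  shows "density M1 (\<lambda>x. ennreal (exp (f x))) \<Otimes>\<^sub>M density M2 (\<lambda>y. ennreal (exp (g y))) =
    density (M1 \<Otimes>\<^sub>M M2) (\<lambda>z. ennreal (exp ((\<lambda>(x, y). f x + g y) z)))"
proof -
  have "sigma_finite_measure (density M2 (\<lambda>y. ennreal (exp (g y))))"
    using M2.density_exp_in_bayes_measures[OF assms(2)] by (simp add: bayes_measures_def)
  then have "density M1 (\<lambda>x. ennreal (exp (f x))) \<Otimes>\<^sub>M density M2 (\<lambda>y. ennreal (exp (g y))) =
      density (M1 \<Otimes>\<^sub>M M2) (\<lambda>(x, y). ennreal (exp (f x)) * ennreal (exp (g y)))"
    by (intro pair_measure_density) (auto intro: M2.sigma_finite_measure_axioms)
  also have "(\<lambda>(x, y). ennreal (exp (f x)) * ennreal (exp (g y))) =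
      (\<lambda>z. ennreal (exp ((\<lambda>(x, y). f x + g y) z)))"
    by (auto simp: exp_add ennreal_mult')
  finally show ?thesis .
qed

lemma bayes_class_pair_density_exp:
  assumes [measurable]: "f \<in> borel_measurable M1" "g \<in> borel_measurable M2"
  defines "F \<equiv> bayes_class (M1 \<Otimes>\<^sub>M M2)
    (density M1 (\<lambda>x. ennreal (exp (f x))) \<Otimes>\<^sub>M density M2 (\<lambda>y. ennreal (exp (g y))))"
  shows "F \<in> bayes_space (M1 \<Otimes>\<^sub>M M2)"
    and "\<exists>c. AE z in M1 \<Otimes>\<^sub>M M2. log_density (M1 \<Otimes>\<^sub>M M2) F z = (\<lambda>(x, y). f x + g y) z + c"
proof -
  have F: "F = class_of_density (M1 \<Otimes>\<^sub>M M2) (\<lambda>z. exp ((\<lambda>(x, y). f x + g y) z))"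
    unfolding F_def pair_measure_density_exp[OF assms(1,2)] class_of_density_def ..
  show "F \<in> bayes_space (M1 \<Otimes>\<^sub>M M2)"
    unfolding F by (rule P.class_of_density_log(1)[where h = "\<lambda>(x, y). f x + g y"]) auto
  show "\<exists>c. AE z in M1 \<Otimes>\<^sub>M M2. log_density (M1 \<Otimes>\<^sub>M M2) F z = (\<lambda>(x, y). f x + g y) z + c"
    unfolding F by (rule P.class_of_density_log(2)) auto
qed

text \<open>A product measure has the product of the densities, whose logarithm is a sum. The additive constant
  by which the logarithm of the class may differ from it is absorbed into the second summand.\<close>

lemma bayes_ind_iff:
  "F \<in> bayes_ind M1 M2 \<longleftrightarrow> F \<in> bayes_space (M1 \<Otimes>\<^sub>M M2) \<and>
    (\<exists>f g. square_integrable M1 f \<and> square_integrable M2 g \<and>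
      (AE z in M1 \<Otimes>\<^sub>M M2. log_density (M1 \<Otimes>\<^sub>M M2) F z = (\<lambda>(x, y). f x + g y) z))"
proof
  assume "F \<in> bayes_ind M1 M2"
  then obtain \<mu>1 \<mu>2 where F: "F \<in> bayes_space (M1 \<Otimes>\<^sub>M M2)"
    and \<mu>1: "\<mu>1 \<in> bayes_measures M1" "bayes_class M1 \<mu>1 \<in> bayes_L2 M1"
    and \<mu>2: "\<mu>2 \<in> bayes_measures M2" "bayes_class M2 \<mu>2 \<in> bayes_L2 M2"
    and eq: "F = bayes_class (M1 \<Otimes>\<^sub>M M2) (\<mu>1 \<Otimes>\<^sub>M \<mu>2)"
    by (auto simp: bayes_ind_def bayes_L2_iff)
  define f g where "f = (\<lambda>x. ln (real_density M1 \<mu>1 x))" and "g = (\<lambda>y. ln (real_density M2 \<mu>2 y))"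
  have f: "square_integrable M1 f" and g: "square_integrable M2 g"
    using \<mu>1 \<mu>2 M1.bayes_class_in_bayes_L2_iff M2.bayes_class_in_bayes_L2_iff by (simp_all add: f_def g_def)
  have "f \<in> borel_measurable M1" "g \<in> borel_measurable M2"
    using f g by (simp_all add: square_integrable_def)
  from bayes_class_pair_density_exp(2)[OF this] obtain c where
    "AE z in M1 \<Otimes>\<^sub>M M2. log_density (M1 \<Otimes>\<^sub>M M2) F z = (\<lambda>(x, y). f x + g y) z + c"
    unfolding eq f_def g_def M1.density_exp_ln_real_density[OF \<mu>1(1)]
      M2.density_exp_ln_real_density[OF \<mu>2(1)] by blast
  then have "AE z in M1 \<Otimes>\<^sub>M M2. log_density (M1 \<Otimes>\<^sub>M M2) F z = (\<lambda>(x, y). f x + (g y + c)) z"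
    by eventually_elim (simp add: case_prod_unfold)
  moreover have "square_integrable M2 (\<lambda>y. g y + c)"
    by (rule square_integrable_add[OF g M2.square_integrable_const])
  ultimately show "F \<in> bayes_space (M1 \<Otimes>\<^sub>M M2) \<and>
    (\<exists>f g. square_integrable M1 f \<and> square_integrable M2 g \<and>
      (AE z in M1 \<Otimes>\<^sub>M M2. log_density (M1 \<Otimes>\<^sub>M M2) F z = (\<lambda>(x, y). f x + g y) z))"
    using F f by (intro conjI exI[of _ f] exI[of _ "\<lambda>y. g y + c"])
next
  assume "F \<in> bayes_space (M1 \<Otimes>\<^sub>M M2) \<and>
    (\<exists>f g. square_integrable M1 f \<and> square_integrable M2 g \<and>
      (AE z in M1 \<Otimes>\<^sub>M M2. log_density (M1 \<Otimes>\<^sub>M M2) F z = (\<lambda>(x, y). f x + g y) z))"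
  then obtain f g where F: "F \<in> bayes_space (M1 \<Otimes>\<^sub>M M2)"
    and f: "square_integrable M1 f" and g: "square_integrable M2 g"
    and log: "AE z in M1 \<Otimes>\<^sub>M M2. log_density (M1 \<Otimes>\<^sub>M M2) F z = (\<lambda>(x, y). f x + g y) z"
    by blast
  have fm: "f \<in> borel_measurable M1" and gm: "g \<in> borel_measurable M2"
    using f g by (simp_all add: square_integrable_def)
  define \<mu>1 \<mu>2 where "\<mu>1 = density M1 (\<lambda>x. ennreal (exp (f x)))"
    and "\<mu>2 = density M2 (\<lambda>y. ennreal (exp (g y)))"
  have \<mu>1: "\<mu>1 \<in> bayes_measures M1" and \<mu>2: "\<mu>2 \<in> bayes_measures M2"
    unfolding \<mu>1_def \<mu>2_def
    by (rule M1.density_exp_in_bayes_measures[OF fm] M2.density_exp_in_bayes_measures[OF gm])+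
  have "square_integrable M1 (\<lambda>x. ln (real_density M1 \<mu>1 x))"
    using M1.ln_real_density_density_exp[OF fm]
    unfolding \<mu>1_def[symmetric] by (intro square_integrable_cong_AE[OF _ f]) (simp_all add: real_density_def)
  then have L1: "bayes_class M1 \<mu>1 \<in> bayes_L2 M1"
    using M1.bayes_class_in_bayes_L2_iff[OF \<mu>1] by simp
  have "square_integrable M2 (\<lambda>x. ln (real_density M2 \<mu>2 x))"
    using M2.ln_real_density_density_exp[OF gm]
    unfolding \<mu>2_def[symmetric] by (intro square_integrable_cong_AE[OF _ g]) (simp_all add: real_density_def)
  then have L2: "bayes_class M2 \<mu>2 \<in> bayes_L2 M2"
    using M2.bayes_class_in_bayes_L2_iff[OF \<mu>2] by simp
  define G where "G = bayes_class (M1 \<Otimes>\<^sub>M M2) (\<mu>1 \<Otimes>\<^sub>M \<mu>2)"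
  have G: "G \<in> bayes_space (M1 \<Otimes>\<^sub>M M2)"
    using bayes_class_pair_density_exp(1)[OF fm gm] by (simp add: G_def \<mu>1_def \<mu>2_def)
  obtain c where "AE z in M1 \<Otimes>\<^sub>M M2. log_density (M1 \<Otimes>\<^sub>M M2) G z = (\<lambda>(x, y). f x + g y) z + c"
    using bayes_class_pair_density_exp(2)[OF fm gm] unfolding G_def \<mu>1_def \<mu>2_def by blast
  with log have "AE z in M1 \<Otimes>\<^sub>M M2. log_density (M1 \<Otimes>\<^sub>M M2) F z = log_density (M1 \<Otimes>\<^sub>M M2) G z + (- c)"
    by eventually_elim simp
  then have "F = G"
    by (rule P.bayes_space_eqI[OF F G])
  moreover have "square_integrable (M1 \<Otimes>\<^sub>M M2) (log_density (M1 \<Otimes>\<^sub>M M2) F)"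
    by (rule square_integrable_cong_AE[OF log_density_measurable square_integrable_sum_of_coordinates[OF f g] log])
  ultimately show "F \<in> bayes_ind M1 M2"
    using F L1 L2 \<mu>1 \<mu>2 unfolding bayes_ind_def bayes_L2_iff G_def by blast
qed

text \<open>Each margin is given by an explicit density \<open>exp(a(x))\<close> or \<open>exp(b(y))\<close>, so three additive constants
  arise: one for each margin and one for their sum.\<close>

lemma independence_part_log:
  fixes F
  defines "a \<equiv> \<lambda>x. 1 / measure M2 (space M2) * (\<integral>z. log_density (M1 \<Otimes>\<^sub>M M2) F (x, z) \<partial>M2)"
    and "b \<equiv> \<lambda>y. 1 / measure M1 (space M1) * (\<integral>z. log_density (M1 \<Otimes>\<^sub>M M2) F (z, y) \<partial>M1)"
  shows "independence_part M1 M2 F \<in> bayes_space (M1 \<Otimes>\<^sub>M M2)"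
    and "\<exists>c. AE z in M1 \<Otimes>\<^sub>M M2. log_density (M1 \<Otimes>\<^sub>M M2) (independence_part M1 M2 F) z =
      (\<lambda>(x, y). a x + b y) z + c"
proof -
  have [measurable]: "a \<in> borel_measurable M1" "b \<in> borel_measurable M2"
    unfolding a_def b_def by measurable
  have A: "geometric_margin1 M1 M2 F = class_of_density (M1 \<Otimes>\<^sub>M M2) (\<lambda>(x, y). exp (a x))"
    and B: "geometric_margin2 M1 M2 F = class_of_density (M1 \<Otimes>\<^sub>M M2) (\<lambda>(x, y). exp (b y))"
    by (simp_all add: geometric_margin1_def geometric_margin2_def a_def b_def log_density_def)
  have A1: "geometric_margin1 M1 M2 F \<in> bayes_space (M1 \<Otimes>\<^sub>M M2)"
    unfolding A by (rule P.class_of_density_log(1)[where h = "\<lambda>(x, y). a x"]) auto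
  have B1: "geometric_margin2 M1 M2 F \<in> bayes_space (M1 \<Otimes>\<^sub>M M2)"
    unfolding B by (rule P.class_of_density_log(1)[where h = "\<lambda>(x, y). b y"]) auto
  have "\<exists>c. AE z in M1 \<Otimes>\<^sub>M M2. log_density (M1 \<Otimes>\<^sub>M M2) (geometric_margin1 M1 M2 F) z = (\<lambda>(x, y). a x) z + c"
    unfolding A by (rule P.class_of_density_log(2)) auto
  then obtain c where c: "AE z in M1 \<Otimes>\<^sub>M M2.
      log_density (M1 \<Otimes>\<^sub>M M2) (geometric_margin1 M1 M2 F) z = (\<lambda>(x, y). a x) z + c" ..
  have "\<exists>d. AE z in M1 \<Otimes>\<^sub>M M2. log_density (M1 \<Otimes>\<^sub>M M2) (geometric_margin2 M1 M2 F) z = (\<lambda>(x, y). b y) z + d"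
    unfolding B by (rule P.class_of_density_log(2)) auto
  then obtain d where d: "AE z in M1 \<Otimes>\<^sub>M M2.
      log_density (M1 \<Otimes>\<^sub>M M2) (geometric_margin2 M1 M2 F) z = (\<lambda>(x, y). b y) z + d" ..
  obtain e where e: "AE z in M1 \<Otimes>\<^sub>M M2. log_density (M1 \<Otimes>\<^sub>M M2) (independence_part M1 M2 F) z =
      log_density (M1 \<Otimes>\<^sub>M M2) (geometric_margin1 M1 M2 F) z +
      log_density (M1 \<Otimes>\<^sub>M M2) (geometric_margin2 M1 M2 F) z + e"
    using P.bayes_add_log(2)[OF A1 B1] unfolding independence_part_def by blast
  show "independence_part M1 M2 F \<in> bayes_space (M1 \<Otimes>\<^sub>M M2)"
    unfolding independence_part_def by (rule P.bayes_add_log(1)[OF A1 B1])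
  have "AE z in M1 \<Otimes>\<^sub>M M2. log_density (M1 \<Otimes>\<^sub>M M2) (independence_part M1 M2 F) z =
      (\<lambda>(x, y). a x + b y) z + (c + d + e)"
    using c d e by eventually_elim (simp add: case_prod_unfold)
  then show "\<exists>c. AE z in M1 \<Otimes>\<^sub>M M2. log_density (M1 \<Otimes>\<^sub>M M2) (independence_part M1 M2 F) z =
      (\<lambda>(x, y). a x + b y) z + c" ..
qed

end

lemma (in pair_finite_measure) independence_part_orthogonal_projection:
  assumes F: "F \<in> bayes_L2 (M1 \<Otimes>\<^sub>M M2)"
    and pos: "measure M1 (space M1) > 0" "measure M2 (space M2) > 0"
  shows "bayes_orthogonal_projection (M1 \<Otimes>\<^sub>M M2) (bayes_ind M1 M2) F (independence_part M1 M2 F)"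
proof -
  define u where "u = log_density (M1 \<Otimes>\<^sub>M M2) F"
  define a where "a = (\<lambda>x. 1 / measure M2 (space M2) * (\<integral>z. u (x, z) \<partial>M2))"
  define b where "b = (\<lambda>y. 1 / measure M1 (space M1) * (\<integral>z. u (z, y) \<partial>M1))"
  have u: "square_integrable (M1 \<Otimes>\<^sub>M M2) u"
    using F by (simp add: bayes_L2_iff u_def)
  have a: "square_integrable M1 a" and b: "square_integrable M2 b"
    unfolding a_def b_def by (fact square_integrable_section_mean1[OF u] square_integrable_section_mean2[OF u])+
  have pos': "measure (M1 \<Otimes>\<^sub>M M2) (space (M1 \<Otimes>\<^sub>M M2)) > 0"
    using pos by (simp add: measure_space_pair)
  note P = independence_part_log(1)[of F]
  obtain c where c: "AE z in M1 \<Otimes>\<^sub>M M2.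
      log_density (M1 \<Otimes>\<^sub>M M2) (independence_part M1 M2 F) z = (\<lambda>(x, y). a x + b y) z + c"
    using independence_part_log(2)[of F] unfolding a_def b_def u_def by blast
  then have "AE z in M1 \<Otimes>\<^sub>M M2.
      log_density (M1 \<Otimes>\<^sub>M M2) (independence_part M1 M2 F) z = (\<lambda>(x, y). a x + (b y + c)) z"
    by eventually_elim (simp add: case_prod_unfold)
  then have "independence_part M1 M2 F \<in> bayes_ind M1 M2"
    using P a square_integrable_add[OF b M2.square_integrable_const[of c]] unfolding bayes_ind_iff by blast
  moreover have "bayes_inner (M1 \<Otimes>\<^sub>M M2) (bayes_diff (M1 \<Otimes>\<^sub>M M2) F (independence_part M1 M2 F)) G = 0"
    if G_ind: "G \<in> bayes_ind M1 M2" for G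
  proof -
    obtain f g where f: "square_integrable M1 f" and g: "square_integrable M2 g"
      and G: "G \<in> bayes_space (M1 \<Otimes>\<^sub>M M2)"
        "AE z in M1 \<Otimes>\<^sub>M M2. log_density (M1 \<Otimes>\<^sub>M M2) G z = (\<lambda>(x, y). f x + g y) z"
      using G_ind unfolding bayes_ind_iff by blast
    have "AE z in M1 \<Otimes>\<^sub>M M2. log_density (M1 \<Otimes>\<^sub>M M2) G z = (\<lambda>(x, y). f x + g y) z + 0"
      using G(2) by simp
    from M.bayes_inner_diff_eq_centred_product[OF F P square_integrable_sum_of_coordinates[OF a b] c
        G(1) square_integrable_sum_of_coordinates[OF f g] this pos']
    have "bayes_inner (M1 \<Otimes>\<^sub>M M2) (bayes_diff (M1 \<Otimes>\<^sub>M M2) F (independence_part M1 M2 F)) G =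
        centred_product (M1 \<Otimes>\<^sub>M M2) (\<lambda>z. u z - (\<lambda>(x, y). a x + b y) z) (\<lambda>(x, y). f x + g y)"
      by (simp add: u_def)
    also have "\<dots> = 0"
      unfolding a_def b_def by (rule residual_orthogonal[OF u f g pos])
    finally show ?thesis .
  qed
  ultimately show ?thesis
    by (simp add: bayes_orthogonal_projection_def)
qed

theorem proposition3p2:
  fixes L1 :: "'a measure" and L2 :: "'b measure" and F :: "('a \<times> 'b) measure set"
  assumes "finite_measure L1" and "emeasure L1 (space L1) \<noteq> 0"
    and "finite_measure L2" and "emeasure L2 (space L2) \<noteq> 0"
    and "F \<in> bayes_L2 (L1 \<Otimes>\<^sub>M L2)"
  shows "bayes_orthogonal_projection (L1 \<Otimes>\<^sub>M L2) (bayes_ind L1 L2) F (independence_part L1 L2 F) \<and>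
    (\<forall>P. bayes_orthogonal_projection (L1 \<Otimes>\<^sub>M L2) (bayes_ind L1 L2) F P \<longrightarrow>
         P = independence_part L1 L2 F)"
proof -
  interpret M1: finite_measure L1 by fact
  interpret M2: finite_measure L2 by fact
  interpret pair_finite_measure L1 L2 ..
  have pos: "measure L1 (space L1) > 0" "measure L2 (space L2) > 0"
    using assms(2,4) by (simp_all add: M1.emeasure_eq_measure M2.emeasure_eq_measure zero_less_measure_iff)
  then have pos': "measure (L1 \<Otimes>\<^sub>M L2) (space (L1 \<Otimes>\<^sub>M L2)) > 0"
    by (simp add: measure_space_pair)
  have sub: "bayes_ind L1 L2 \<subseteq> bayes_L2 (L1 \<Otimes>\<^sub>M L2)"
    by (auto simp: bayes_ind_def)
  note proj = independence_part_orthogonal_projection[OF assms(5) pos]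
  with M.bayes_orthogonal_projection_unique[OF sub assms(5) pos'] show ?thesis
    by blast
qed

end
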